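(* There exist two one-parameter families of rhombus relative equilibria of the four-vortex problem with vortex strengths $\Gamma_1=\Gamma_2=1$ and $\Gamma_3=\Gamma_4=m$, where $m\in(-1,1]$, $m\neq0$. The vortices 1 and 2 lie opposite each other, as do vortices 3 and 4. Let $\beta=3-3m$. The mutual distances are given by $$\left(\frac{r_{34}}{r_{12}}\right)^2=\frac12\left(\beta\pm\sqrt{\beta^2+4m}\right)\quad\text{and}\quad\left(\frac{r_{13}}{r_{12}}\right)^2=\frac18\left(\beta+2\pm\sqrt{\beta^2+4m}\right),$$ (the same sign being taken in both formulas), describing two distinct solutions. Taking $+$ yields a solution for $m\in(-1,1]$ that always has $\lambda>0$. Taking $-$ yields a solution for $m\in(-1,0)$ that has $\lambda>0$ for $m\in(-2+\sqrt3,0)$, but $\lambda<0$ for $m\in(-1,-2+\sqrt3)$. At $m=-2+\sqrt3$, the $-$ solution becomes an equilibrium. The case $m=1$ reduces to the square. For $0<m<1$, the larger pair of vortices (those of larger strength) lie on the shorter diagonal.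
   Context: Four point vortices have distinct positions $x_i\in\mathbb{R}^2$ and strengths $\Gamma_i\ne0$; $r_{ij}=\|x_i-x_j\|$. The configuration is a relative equilibrium (central configuration) with angular velocity $\lambda\in\mathbb{R}\setminus\{0\}$ if there is $c\in\mathbb{R}^2$ with $-\lambda(x_i-c)=\sum_{j\ne i}\frac{\Gamma_j}{r_{ij}^2}(x_j-x_i)$ for $i=1,\dots,4$. It is an equilibrium if these equations hold with $\lambda=0$. The rhombus has all four sides equal, $r_{13}=r_{14}=r_{23}=r_{24}$, with diagonals $r_{12}$ and $r_{34}$. *)

theory Defs
  imports "HOL-Analysis.Analysis"
begin

text \<open>Planar vortices are indexed by a finite type \<open>'n\<close>; \<open>x $ i\<close> is the position and \<open>\<Gamma> $ i\<close> the
  strength of vortex \<open>i\<close>. For four vortices the index type is \<open>4\<close>, in which the numeral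
  \<open>4\<close> denotes the same index as \<open>0\<close>.\<close>

definition vortex_configuration :: "real^'n \<Rightarrow> real^2^'n \<Rightarrow> bool" where
  "vortex_configuration \<Gamma> x \<longleftrightarrow> (\<forall>i. \<Gamma> $ i \<noteq> 0) \<and> (\<forall>i j. i \<noteq> j \<longrightarrow> x $ i \<noteq> x $ j)"

definition vortex_equations :: "real^'n \<Rightarrow> real^2^'n \<Rightarrow> real \<Rightarrow> bool" where
  "vortex_equations \<Gamma> x l \<longleftrightarrow>
     (\<exists>c. \<forall>i. - l *\<^sub>R (x $ i - c) =
        (\<Sum>j\<in>UNIV - {i}. (\<Gamma> $ j / (dist (x $ i) (x $ j))\<^sup>2) *\<^sub>R (x $ j - x $ i)))"

definition relative_equilibrium :: "real^'n \<Rightarrow> real^2^'n \<Rightarrow> real \<Rightarrow> bool" where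
  "relative_equilibrium \<Gamma> x l \<longleftrightarrow>
     vortex_configuration \<Gamma> x \<and> l \<noteq> 0 \<and> vortex_equations \<Gamma> x l"

definition vortex_equilibrium :: "real^'n \<Rightarrow> real^2^'n \<Rightarrow> bool" where
  "vortex_equilibrium \<Gamma> x \<longleftrightarrow> vortex_configuration \<Gamma> x \<and> vortex_equations \<Gamma> x 0"

definition pair_strengths :: "real \<Rightarrow> real^4" where
  "pair_strengths m = (\<chi> i. if i = 1 \<or> i = 2 then 1 else m)"

definition mutual_dist :: "real^2^'n \<Rightarrow> 'n \<Rightarrow> 'n \<Rightarrow> real" where
  "mutual_dist x i j = dist (x $ i) (x $ j)"

text \<open>For distinct points of the plane, equality of these four distances forces \<open>x $ 1, x $ 2\<close> and
  \<open>x $ 3, x $ 4\<close> to be the two pairs of opposite vertices of a rhombus.\<close>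

definition rhombus :: "real^2^4 \<Rightarrow> bool" where
  "rhombus x \<longleftrightarrow>
     mutual_dist x 1 3 = mutual_dist x 1 4 \<and>
     mutual_dist x 1 4 = mutual_dist x 2 3 \<and>
     mutual_dist x 2 3 = mutual_dist x 2 4"

definition is_square :: "real^2^4 \<Rightarrow> bool" where
  "is_square x \<longleftrightarrow> rhombus x \<and> mutual_dist x 1 2 = mutual_dist x 3 4"

text \<open>The sign \<open>\<plusminus>\<close> is \<open>s = 1\<close> or \<open>s = -1\<close>.\<close>

definition rhombus_distances :: "real \<Rightarrow> real \<Rightarrow> real^2^4 \<Rightarrow> bool" where
  "rhombus_distances s m x \<longleftrightarrow>
     (let \<beta> = 3 - 3 * m in
       (mutual_dist x 3 4 / mutual_dist x 1 2)\<^sup>2 = 1/2 * (\<beta> + s * sqrt (\<beta>\<^sup>2 + 4 * m)) \<and>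
       (mutual_dist x 1 3 / mutual_dist x 1 2)\<^sup>2 = 1/8 * (\<beta> + 2 + s * sqrt (\<beta>\<^sup>2 + 4 * m)))"

text \<open>Relative equilibria are counted up to similarities of the plane.\<close>

definition similar_configurations :: "real^2^'n \<Rightarrow> real^2^'n \<Rightarrow> bool" where
  "similar_configurations x y \<longleftrightarrow>
     (\<exists>k>0. \<forall>i j. mutual_dist x i j = k * mutual_dist y i j)"

end

theory Submission
  imports Defs
begin

text \<open>Scaling the plane so that \<open>r\<^sub>1\<^sub>2 = 2\<close> places the rhombus with its centre at the origin and its
  diagonals on the axes, at \<open>(\<plusminus>1, 0)\<close> and \<open>(0, \<plusminus>y)\<close>; the only shape parameter is the squared
  ratio of diagonals \<open>t = y\<^sup>2\<close>. By symmetry each vortex is driven along its own diagonal, so the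
  vector equations collapse to two scalar ones, one for each pair:
  \<open>\<lambda> = 1/2 + 2m/(1+t)\<close> and \<open>\<lambda> = m/(2t) + 2/(1+t)\<close> (\<open>vortex_equations_rhombus\<close>). They are
  compatible exactly when \<open>q(t) = t\<^sup>2 - \<beta>t - m = 0\<close>, whose roots are the two families.

  Everything else is a question about the position of the roots of \<open>q\<close>. Both have to be positive
  where they are used, which follows from their sum \<open>\<beta>\<close> and product \<open>-m\<close>. The first formula
  for \<open>\<lambda>\<close> makes its sign that of \<open>t - t\<^sub>0\<close> with \<open>t\<^sub>0 = -1 - 4m\<close>. For \<open>m > -1\<close> this
  \<open>t\<^sub>0\<close> lies to the left of the vertex \<open>\<beta>/2\<close>, hence of the larger root, so the \<open>+\<close> family always has
  \<open>\<lambda> > 0\<close>; and the smaller root lies to the right of \<open>t\<^sub>0\<close>, at it, or to the left of it according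
  to the sign of \<open>q(t\<^sub>0) = 4(m\<^sup>2 + 4m + 1)\<close>, which changes at \<open>m = -2 + \<surd>3\<close>. Finally
  \<open>q(1) = 2(m - 1)\<close> puts the larger root beyond \<open>1\<close> when \<open>0 < m < 1\<close> and equal to \<open>1\<close>,
  the square, when \<open>m = 1\<close>.\<close>

section \<open>Vortex equations on a rhombus\<close>

definition axis_rhombus :: "real \<Rightarrow> real^2^4" where
  "axis_rhombus y = (\<chi> i. if i = 1 then axis 1 1 else if i = 2 then - axis 1 1
     else if i = 3 then y *\<^sub>R axis 2 1 else - (y *\<^sub>R axis 2 1))"

lemma index_4_distinct [simp]:
  "(1::4) \<noteq> 2" "(1::4) \<noteq> 3" "(1::4) \<noteq> 4" "(2::4) \<noteq> 1" "(2::4) \<noteq> 3" "(2::4) \<noteq> 4"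
  "(3::4) \<noteq> 1" "(3::4) \<noteq> 2" "(3::4) \<noteq> 4" "(4::4) \<noteq> 1" "(4::4) \<noteq> 2" "(4::4) \<noteq> 3"
  by simp_all

lemma axis_rhombus_nth:
  "axis_rhombus y $ 1 = axis 1 1" "axis_rhombus y $ 2 = - axis 1 1"
  "axis_rhombus y $ 3 = y *\<^sub>R axis 2 1" "axis_rhombus y $ 4 = - (y *\<^sub>R axis 2 1)"
  by (simp_all only: axis_rhombus_def vec_lambda_beta index_4_distinct if_True if_False simp_thms)

lemma pair_strengths_nth:
  "pair_strengths m $ 1 = 1" "pair_strengths m $ 2 = 1"
  "pair_strengths m $ 3 = m" "pair_strengths m $ 4 = m"
  by (simp_all only: pair_strengths_def vec_lambda_beta index_4_distinct if_True if_False simp_thms)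

lemma dist_2:
  fixes u v :: "real^2"
  shows "dist u v = sqrt ((u $ 1 - v $ 1)\<^sup>2 + (u $ 2 - v $ 2)\<^sup>2)"
  by (simp add: dist_vec_def L2_set_def sum_2 dist_real_def)

lemma mutual_dist_axis_rhombus:
  assumes "y \<ge> 0"
  shows "mutual_dist (axis_rhombus y) 1 2 = 2" "mutual_dist (axis_rhombus y) 3 4 = 2 * y"
    "mutual_dist (axis_rhombus y) 1 3 = sqrt (1 + y\<^sup>2)" "mutual_dist (axis_rhombus y) 1 4 = sqrt (1 + y\<^sup>2)"
    "mutual_dist (axis_rhombus y) 2 3 = sqrt (1 + y\<^sup>2)" "mutual_dist (axis_rhombus y) 2 4 = sqrt (1 + y\<^sup>2)"
  using assms by (simp_all only: mutual_dist_def axis_rhombus_nth, simp_all add: dist_2 axis_def real_sqrt_mult)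

lemma rhombus_axis_rhombus: "y \<ge> 0 \<Longrightarrow> rhombus (axis_rhombus y)"
  by (simp only: rhombus_def mutual_dist_axis_rhombus simp_thms)

lemma vortex_configuration_axis_rhombus:
  assumes "m \<noteq> 0" "y > 0"
  shows "vortex_configuration (pair_strengths m) (axis_rhombus y)"
  using assms
  by (simp only: vortex_configuration_def forall_4 pair_strengths_nth axis_rhombus_nth
        index_4_distinct simp_thms, simp add: vec_eq_iff axis_def forall_2)

text \<open>Opposite vortices satisfy opposite equations about the origin. Hence the equations of 1 and 2
  give \<open>\<lambda>c = 0\<close>, and each pair leaves one scalar equation along its own diagonal.\<close>

lemma vortex_equations_rhombus:
  assumes "y > 0"
  shows "vortex_equations (pair_strengths m) (axis_rhombus y) l \<longleftrightarrow>
    l = 1/2 + 2 * m / (1 + y\<^sup>2) \<and> l = m / (2 * y\<^sup>2) + 2 / (1 + y\<^sup>2)"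
proof -
  have others: "UNIV - {1::4} = {2,3,4}" "UNIV - {2::4} = {1,3,4}"
    "UNIV - {3::4} = {1,2,4}" "UNIV - {4::4} = {1,2,3}"
    unfolding UNIV_4 by (simp_all add: insert_Diff_if)
  have [simp]: "1 + y\<^sup>2 > 0" "1 + y\<^sup>2 \<noteq> 0"
    by (simp_all add: add_pos_nonneg add_nonneg_eq_0_iff)
  have dists: "(dist (axis_rhombus y $ i) (axis_rhombus y $ j))\<^sup>2 = (mutual_dist (axis_rhombus y) i j)\<^sup>2"
    for i j
    by (simp add: mutual_dist_def)
  have flips: "mutual_dist (axis_rhombus y) 2 1 = mutual_dist (axis_rhombus y) 1 2"
    "mutual_dist (axis_rhombus y) 3 1 = mutual_dist (axis_rhombus y) 1 3"
    "mutual_dist (axis_rhombus y) 4 1 = mutual_dist (axis_rhombus y) 1 4"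
    "mutual_dist (axis_rhombus y) 3 2 = mutual_dist (axis_rhombus y) 2 3"
    "mutual_dist (axis_rhombus y) 4 2 = mutual_dist (axis_rhombus y) 2 4"
    "mutual_dist (axis_rhombus y) 4 3 = mutual_dist (axis_rhombus y) 3 4"
    by (simp_all only: mutual_dist_def dist_commute)
  \<comment> \<open>The pulls on vortices 1 and 3 towards the centre are \<open>a\<close> and \<open>b y\<close>. The last two conjuncts of
    the next equivalence are the components across the diagonals, where all forces cancel.\<close>
  define a where "a = 1/2 + 2 * m / (1 + y\<^sup>2)"
  define b where "b = m / (2 * y\<^sup>2) + 2 / (1 + y\<^sup>2)"
  have b_y: "b * y = 2 * y / (1 + y\<^sup>2) + m * y / (2 * y\<^sup>2)"
    by (simp add: b_def algebra_simps)
  have "(\<forall>i. - l *\<^sub>R (axis_rhombus y $ i - c) =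
        (\<Sum>j\<in>UNIV - {i}. (pair_strengths m $ j / (dist (axis_rhombus y $ i) (axis_rhombus y $ j))\<^sup>2)
           *\<^sub>R (axis_rhombus y $ j - axis_rhombus y $ i))) \<longleftrightarrow>
      l * (1 - c $ 1) = a \<and> l * (1 + c $ 1) = a \<and> l * (y - c $ 2) = b * y \<and> l * (y + c $ 2) = b * y
      \<and> l * c $ 1 = 0 \<and> l * c $ 2 = 0" for c
    unfolding forall_4 others
    by (simp only: dists flips sum.insert finite.intros index_4_distinct insert_iff empty_iff simp_thms
        sum.empty mutual_dist_axis_rhombus[OF less_imp_le[OF assms]])
      (auto simp: assms[THEN less_imp_neq, symmetric] pair_strengths_nth axis_rhombus_nth vec_eq_iff
        forall_2 axis_def a_def b_y algebra_simps)
  then have "vortex_equations (pair_strengths m) (axis_rhombus y) l \<longleftrightarrow>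
     (\<exists>c::real^2. l * (1 - c $ 1) = a \<and> l * (1 + c $ 1) = a \<and> l * (y - c $ 2) = b * y
       \<and> l * (y + c $ 2) = b * y \<and> l * c $ 1 = 0 \<and> l * c $ 2 = 0)"
    unfolding vortex_equations_def by simp
  also have "\<dots> \<longleftrightarrow> l = a \<and> l = b"
  proof
    assume "l = a \<and> l = b"
    then show "\<exists>c::real^2. l * (1 - c $ 1) = a \<and> l * (1 + c $ 1) = a \<and> l * (y - c $ 2) = b * y
       \<and> l * (y + c $ 2) = b * y \<and> l * c $ 1 = 0 \<and> l * c $ 2 = 0"
      by (intro exI[of _ 0]) simp
  qed (use assms in \<open>auto simp: algebra_simps\<close>)
  finally show ?thesis
    by (simp only: a_def b_def)
qed

section \<open>Roots of the shape equation\<close>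

text \<open>For \<open>s = \<plusminus>1\<close>, the roots of \<open>t\<^sup>2 - \<beta>t - m\<close> with \<open>\<beta> = 3 - 3m\<close>.\<close>

definition shape_root :: "real \<Rightarrow> real \<Rightarrow> real" where
  "shape_root s m = 1/2 * ((3 - 3 * m) + s * sqrt ((3 - 3 * m)\<^sup>2 + 4 * m))"

lemma discriminant_pos: "(3 - 3 * m)\<^sup>2 + 4 * m > (0::real)"
proof -
  have "(3 - 3 * m)\<^sup>2 + 4 * m = (3 * m - 7/3)\<^sup>2 + 32/9"
    by (simp add: power2_eq_square algebra_simps)
  then show ?thesis
    by (smt (verit) zero_le_power2 divide_pos_pos)
qed

text \<open>The sign of the right-hand side at a point \<open>t\<close> tells whether \<open>t\<close> lies between the roots;
  together with the midpoint \<open>\<beta>/2\<close> below this locates \<open>t\<close> without estimating a square root.\<close>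

lemma shape_polynomial_factors:
  "(t - shape_root 1 m) * (t - shape_root (-1) m) = t\<^sup>2 - (3 - 3 * m) * t - m"
proof -
  have "(sqrt ((3 - 3 * m)\<^sup>2 + 4 * m))\<^sup>2 = (3 - 3 * m)\<^sup>2 + 4 * m"
    using discriminant_pos[of m] by simp
  then show ?thesis
    unfolding shape_root_def by (simp add: power2_eq_square field_simps)
qed

lemma shape_root_midpoint:
  "shape_root (-1) m < (3 - 3 * m) / 2" "(3 - 3 * m) / 2 < shape_root 1 m"
  using discriminant_pos[of m] by (simp_all add: shape_root_def)

lemma shape_root_equation:
  assumes "s = 1 \<or> s = -1"
  shows "(shape_root s m)\<^sup>2 - (3 - 3 * m) * shape_root s m - m = 0"
  using assms shape_polynomial_factors[of "shape_root s m" m] by auto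

lemma shape_root_plus_pos:
  assumes "m \<le> 1"
  shows "shape_root 1 m > 0"
  using shape_root_midpoint(2)[of m] assms by simp

text \<open>The product of the roots is \<open>-m\<close>, so for negative \<open>m\<close> they have the same sign.\<close>

lemma shape_root_minus_pos:
  assumes "m < 0"
  shows "shape_root (-1) m > 0"
proof -
  have "shape_root 1 m * shape_root (-1) m > 0"
    using shape_polynomial_factors[of 0 m] assms by simp
  then show ?thesis
    using shape_root_plus_pos[of m] assms by (simp add: zero_less_mult_iff)
qed

text \<open>The sign of \<open>\<lambda>\<close> is that of \<open>t + 1 + 4m\<close>, which vanishes at \<open>t\<^sub>0 = -1 - 4m\<close>. This is below
  the midpoint, since \<open>\<beta>/2 - t\<^sub>0 = 5(1 + m)/2\<close>.\<close>

lemma shape_root_plus_threshold: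
  assumes "m > -1"
  shows "shape_root 1 m + 1 + 4 * m > 0"
  using shape_root_midpoint(2)[of m] assms by (simp add: field_simps)

text \<open>As the larger root lies to the right of \<open>t\<^sub>0\<close>, the value \<open>4(m\<^sup>2 + 4m + 1)\<close> of the polynomial at
  \<open>t\<^sub>0\<close> decides the side of the smaller one; of the two zeros \<open>-2 \<plusminus> \<surd>3\<close> of this value
  only \<open>-2 + \<surd>3\<close> exceeds \<open>-1\<close>.\<close>

lemma shape_root_minus_threshold:
  assumes "m > -1"
  shows "shape_root (-1) m + 1 + 4 * m > 0 \<longleftrightarrow> m > -2 + sqrt 3"
    and "shape_root (-1) m + 1 + 4 * m < 0 \<longleftrightarrow> m < -2 + sqrt 3"
proof -
  have "(shape_root 1 m + 1 + 4 * m) * (shape_root (-1) m + 1 + 4 * m) = 4 * (m\<^sup>2 + 4 * m + 1)"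
    using shape_polynomial_factors[of "-1 - 4 * m" m] by (simp add: power2_eq_square algebra_simps)
  also have "\<dots> = 4 * (m + 2 + sqrt 3) * (m - (-2 + sqrt 3))"
    by (simp add: power2_eq_square algebra_simps)
  finally have eq: "(shape_root 1 m + 1 + 4 * m) * (shape_root (-1) m + 1 + 4 * m)
      = 4 * (m + 2 + sqrt 3) * (m - (-2 + sqrt 3))" .
  have pos: "4 * (m + 2 + sqrt 3) > 0" "shape_root 1 m + 1 + 4 * m > 0"
    using assms shape_root_plus_threshold[OF assms] by (simp_all add: add_pos_pos)
  have "shape_root (-1) m + 1 + 4 * m > 0 \<longleftrightarrow> m - (-2 + sqrt 3) > 0"
    using eq pos by (metis zero_less_mult_pos mult_pos_pos)
  then show "shape_root (-1) m + 1 + 4 * m > 0 \<longleftrightarrow> m > -2 + sqrt 3"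
    by simp
  have "shape_root (-1) m + 1 + 4 * m < 0 \<longleftrightarrow> m - (-2 + sqrt 3) < 0"
    using eq pos by (metis mult_less_0_iff less_asym)
  then show "shape_root (-1) m + 1 + 4 * m < 0 \<longleftrightarrow> m < -2 + sqrt 3"
    by simp
qed

lemma threshold_bounds: "-1 < -2 + sqrt (3::real)" "-2 + sqrt (3::real) < 0"
  using real_less_rsqrt[of 1 3] real_less_lsqrt[of 2 3] by simp_all

section \<open>The two families\<close>

definition shape_rhombus :: "real \<Rightarrow> real \<Rightarrow> real^2^4" where
  "shape_rhombus s m = axis_rhombus (sqrt (shape_root s m))"

lemma continuous_on_shape_rhombus: "continuous_on S (shape_rhombus s)"
proof -
  have "continuous_on S (\<lambda>m. sqrt (shape_root s m))"
    unfolding shape_root_def by (intro continuous_intros)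
  moreover have "continuous_on UNIV axis_rhombus"
    unfolding axis_rhombus_def continuous_on_def
    by (auto intro!: tendsto_intros tendsto_vec_lambda)
  ultimately show ?thesis
    unfolding shape_rhombus_def by (auto intro: continuous_on_compose2)
qed

lemma rhombus_distances_shape_rhombus:
  assumes "shape_root s m > 0"
  shows "rhombus_distances s m (shape_rhombus s m)"
proof -
  define t where "t = shape_root s m"
  have t: "t > 0" "(3 - 3 * m) + s * sqrt ((3 - 3 * m)\<^sup>2 + 4 * m) = 2 * t"
    using assms by (simp_all add: t_def shape_root_def)
  then have "(3 - 3 * m) + 2 + s * sqrt ((3 - 3 * m)\<^sup>2 + 4 * m) = 2 * t + 2"
    by simp
  then show ?thesis
    using t
    unfolding rhombus_distances_def shape_rhombus_def t_def[symmetric] Let_def t(2)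
    by (simp add: mutual_dist_axis_rhombus power_divide)
qed

text \<open>On a root of the shape equation the two scalar equations agree, so \<open>\<lambda>\<close> is determined.\<close>

lemma vortex_equations_shape_rhombus:
  assumes "s = 1 \<or> s = -1" and t: "shape_root s m > 0"
  shows "vortex_equations (pair_strengths m) (shape_rhombus s m) l \<longleftrightarrow>
    l = (shape_root s m + 1 + 4 * m) / (2 * (1 + shape_root s m))"
proof -
  define t where "t = shape_root s m"
  have t0: "t > 0"
    using t by (simp add: t_def)
  have "t\<^sup>2 - (3 - 3 * m) * t - m = 0"
    using shape_root_equation[OF assms(1)] by (simp add: t_def)
  \<comment> \<open>The shape polynomial is the numerator of the difference of the two formulas for \<open>\<lambda>\<close>.\<close>
  moreover have "(1/2 + 2 * m / (1 + t)) - (m / (2 * t) + 2 / (1 + t))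
      = (t\<^sup>2 - (3 - 3 * m) * t - m) / (2 * t * (1 + t))"
    using t0 by (simp add: divide_simps power2_eq_square) (simp add: algebra_simps)
  ultimately have "1/2 + 2 * m / (1 + t) = m / (2 * t) + 2 / (1 + t)"
    by simp
  moreover have "1/2 + 2 * m / (1 + t) = (t + 1 + 4 * m) / (2 * (1 + t))"
    using t0 by (simp add: field_simps)
  ultimately show ?thesis
    using t0 unfolding shape_rhombus_def t_def[symmetric]
    by (simp add: vortex_equations_rhombus)
qed

lemma vortex_configuration_shape_rhombus:
  assumes "m \<noteq> 0" "shape_root s m > 0"
  shows "vortex_configuration (pair_strengths m) (shape_rhombus s m)"
  using assms by (simp add: shape_rhombus_def vortex_configuration_axis_rhombus)

lemma relative_equilibrium_shape_rhombus:
  assumes "m \<noteq> 0" "s = 1 \<or> s = -1" "shape_root s m > 0"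
  shows "relative_equilibrium (pair_strengths m) (shape_rhombus s m) l \<longleftrightarrow>
    l \<noteq> 0 \<and> l = (shape_root s m + 1 + 4 * m) / (2 * (1 + shape_root s m))"
  using assms
  by (simp add: relative_equilibrium_def vortex_equations_shape_rhombus vortex_configuration_shape_rhombus)

text \<open>Similarities preserve the ratio of the diagonals.\<close>

lemma not_similar_axis_rhombus:
  assumes "y > 0" "z > 0" "y \<noteq> z"
  shows "\<not> similar_configurations (axis_rhombus y) (axis_rhombus z)"
proof
  assume "similar_configurations (axis_rhombus y) (axis_rhombus z)"
  then obtain k where "\<And>i j. mutual_dist (axis_rhombus y) i j = k * mutual_dist (axis_rhombus z) i j"
    unfolding similar_configurations_def by blast
  from this[of 1 2] this[of 3 4] show False
    using assms by (simp add: mutual_dist_axis_rhombus)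
qed

theorem theorem7p7:
  "\<exists>P M :: real \<Rightarrow> real^2^4.
     continuous_on ({-1<..1} - {0}) P \<and>
     continuous_on {-1<..<0} M \<and>
     (\<forall>m\<in>{-1<..1} - {0}.
        rhombus (P m) \<and> rhombus_distances 1 m (P m) \<and>
        (\<exists>l. relative_equilibrium (pair_strengths m) (P m) l) \<and>
        (\<forall>l. relative_equilibrium (pair_strengths m) (P m) l \<longrightarrow> l > 0)) \<and>
     (\<forall>m\<in>{-1<..<0}.
        rhombus (M m) \<and> rhombus_distances (-1) m (M m) \<and>
        \<not> similar_configurations (P m) (M m)) \<and>
     (\<forall>m\<in>{-2 + sqrt 3<..<0}.
        (\<exists>l. relative_equilibrium (pair_strengths m) (M m) l) \<and>
        (\<forall>l. relative_equilibrium (pair_strengths m) (M m) l \<longrightarrow> l > 0)) \<and>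
     (\<forall>m\<in>{-1<..<-2 + sqrt 3}.
        (\<exists>l. relative_equilibrium (pair_strengths m) (M m) l) \<and>
        (\<forall>l. relative_equilibrium (pair_strengths m) (M m) l \<longrightarrow> l < 0)) \<and>
     vortex_equilibrium (pair_strengths (-2 + sqrt 3)) (M (-2 + sqrt 3)) \<and>
     is_square (P 1) \<and>
     (\<forall>m\<in>{0<..<1}. mutual_dist (P m) 1 2 < mutual_dist (P m) 3 4)"
proof (rule exI[of _ "shape_rhombus 1"], rule exI[of _ "shape_rhombus (-1)"], intro conjI)
  show "continuous_on ({-1<..1} - {0}) (shape_rhombus 1)" "continuous_on {-1<..<0} (shape_rhombus (-1))"
    by (rule continuous_on_shape_rhombus)+
  show "\<forall>m\<in>{-1<..1} - {0}.
        rhombus (shape_rhombus 1 m) \<and> rhombus_distances 1 m (shape_rhombus 1 m) \<and>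
        (\<exists>l. relative_equilibrium (pair_strengths m) (shape_rhombus 1 m) l) \<and>
        (\<forall>l. relative_equilibrium (pair_strengths m) (shape_rhombus 1 m) l \<longrightarrow> l > 0)"
  proof
    fix m :: real
    assume m: "m \<in> {-1<..1} - {0}"
    then have t: "shape_root 1 m > 0" and num: "shape_root 1 m + 1 + 4 * m > 0"
      by (auto intro: shape_root_plus_pos shape_root_plus_threshold)
    then have "(shape_root 1 m + 1 + 4 * m) / (2 * (1 + shape_root 1 m)) > 0"
      by (simp add: divide_pos_pos)
    then show "rhombus (shape_rhombus 1 m) \<and> rhombus_distances 1 m (shape_rhombus 1 m) \<and>
        (\<exists>l. relative_equilibrium (pair_strengths m) (shape_rhombus 1 m) l) \<and>
        (\<forall>l. relative_equilibrium (pair_strengths m) (shape_rhombus 1 m) l \<longrightarrow> l > 0)"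
      using m t by (auto simp: relative_equilibrium_shape_rhombus rhombus_distances_shape_rhombus)
        (simp add: shape_rhombus_def rhombus_axis_rhombus)
  qed
  show "\<forall>m\<in>{-1<..<0}. rhombus (shape_rhombus (-1) m) \<and> rhombus_distances (-1) m (shape_rhombus (-1) m) \<and>
        \<not> similar_configurations (shape_rhombus 1 m) (shape_rhombus (-1) m)"
  proof
    fix m :: real
    assume "m \<in> {-1<..<0}"
    then have t: "shape_root 1 m > 0" "shape_root (-1) m > 0"
      by (auto intro: shape_root_plus_pos shape_root_minus_pos)
    moreover have "shape_root 1 m \<noteq> shape_root (-1) m"
      using shape_root_midpoint[of m] by linarith
    ultimately show "rhombus (shape_rhombus (-1) m) \<and> rhombus_distances (-1) m (shape_rhombus (-1) m) \<and>
        \<not> similar_configurations (shape_rhombus 1 m) (shape_rhombus (-1) m)"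
      by (simp add: rhombus_distances_shape_rhombus)
        (simp add: shape_rhombus_def rhombus_axis_rhombus not_similar_axis_rhombus)
  qed
  show "\<forall>m\<in>{-2 + sqrt 3<..<0}.
        (\<exists>l. relative_equilibrium (pair_strengths m) (shape_rhombus (-1) m) l) \<and>
        (\<forall>l. relative_equilibrium (pair_strengths m) (shape_rhombus (-1) m) l \<longrightarrow> l > 0)"
  proof
    fix m :: real
    assume m: "m \<in> {-2 + sqrt 3<..<0}"
    have "m > -1"
      using threshold_bounds(1) m by (meson greaterThanLessThan_iff less_trans)
    then have t: "shape_root (-1) m > 0" and num: "shape_root (-1) m + 1 + 4 * m > 0"
      using m by (auto simp: shape_root_minus_pos shape_root_minus_threshold)
    then have "(shape_root (-1) m + 1 + 4 * m) / (2 * (1 + shape_root (-1) m)) > 0"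
      by (simp add: divide_pos_pos)
    then show "(\<exists>l. relative_equilibrium (pair_strengths m) (shape_rhombus (-1) m) l) \<and>
        (\<forall>l. relative_equilibrium (pair_strengths m) (shape_rhombus (-1) m) l \<longrightarrow> l > 0)"
      using m t by (auto simp: relative_equilibrium_shape_rhombus)
  qed
  show "\<forall>m\<in>{-1<..<-2 + sqrt 3}.
        (\<exists>l. relative_equilibrium (pair_strengths m) (shape_rhombus (-1) m) l) \<and>
        (\<forall>l. relative_equilibrium (pair_strengths m) (shape_rhombus (-1) m) l \<longrightarrow> l < 0)"
  proof
    fix m :: real
    assume m: "m \<in> {-1<..<-2 + sqrt 3}"
    then have m0: "m < 0"
      using m threshold_bounds by simp
    then have t: "shape_root (-1) m > 0" and num: "shape_root (-1) m + 1 + 4 * m < 0"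
      using m by (auto simp: shape_root_minus_pos shape_root_minus_threshold)
    then have "(shape_root (-1) m + 1 + 4 * m) / (2 * (1 + shape_root (-1) m)) < 0"
      by (simp add: divide_neg_pos)
    then show "(\<exists>l. relative_equilibrium (pair_strengths m) (shape_rhombus (-1) m) l) \<and>
        (\<forall>l. relative_equilibrium (pair_strengths m) (shape_rhombus (-1) m) l \<longrightarrow> l < 0)"
      using m0 t by (auto simp: relative_equilibrium_shape_rhombus)
  qed
  show "vortex_equilibrium (pair_strengths (-2 + sqrt 3)) (shape_rhombus (-1) (-2 + sqrt 3))"
  proof -
    define m :: real where "m = -2 + sqrt 3"
    have m: "-1 < m" "m < 0"
      using threshold_bounds by (simp_all add: m_def)
    have t: "shape_root (-1) m > 0"
      using m by (simp add: shape_root_minus_pos)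
    have "shape_root (-1) m + 1 + 4 * m = 0"
      using shape_root_minus_threshold[OF m(1)] by (simp add: m_def)
    then show ?thesis
      using m t unfolding m_def[symmetric] vortex_equilibrium_def
      by (simp add: vortex_configuration_shape_rhombus vortex_equations_shape_rhombus)
  qed
  have "shape_root 1 1 = 1"
    by (simp add: shape_root_def)
  then show "is_square (shape_rhombus 1 1)"
    by (simp add: is_square_def shape_rhombus_def rhombus_axis_rhombus mutual_dist_axis_rhombus)
  show "\<forall>m\<in>{0<..<1}. mutual_dist (shape_rhombus 1 m) 1 2 < mutual_dist (shape_rhombus 1 m) 3 4"
  proof
    fix m :: real
    assume m: "m \<in> {0<..<1}"
    have "(1 - shape_root 1 m) * (1 - shape_root (-1) m) < 0"
      using shape_polynomial_factors[of 1 m] m by simp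
    then have "shape_root 1 m > 1"
      using shape_root_midpoint[of m] by (auto simp: mult_less_0_iff)
    then show "mutual_dist (shape_rhombus 1 m) 1 2 < mutual_dist (shape_rhombus 1 m) 3 4"
      by (simp add: shape_rhombus_def mutual_dist_axis_rhombus)
  qed
qed

end
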